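(* Let $k\geq1$ and $1\leq d\leq k$. For $n\geq0$ let \[ S_{(k,k),d,n}(s_1,\dotsc,s_d)=\sum_{w}\prod_{i:\,a_i\neq\infty}s_{a_i}, \] where $w=a_1\cdots a_n$ ranges over all words over $\{1,\dotsc,d,\infty\}$ with $a_n=\infty$ (for $n\geq1$) such that $a_i\neq\infty$ implies $a_{i+1}\geq a_i+k$ ($\infty$ larger than every integer). Then \[ \sum_{n\geq0}S_{(k,k),d,n}(s_1,\dotsc,s_d)x^n=\frac{1}{1-x-(s_1+\cdots+s_d)x^2}, \] equivalently $S_{(k,k),d,n}(s_1,\dotsc,s_d)=\sum_{j=0}^{\lfloor n/2\rfloor}\binom{n-j}{j}(s_1+\cdots+s_d)^j$. In particular, for every $n\geq0$ the univariate polynomial $S_{(k,k),d,n}(s,1,\dotsc,1)=\sum_{j=0}^{\lfloor n/2\rfloor}\binom{n-j}{j}(s+d-1)^j$ in $s$ is real-rooted. *)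

theory Defs
  imports Complex_Main
    "HOL-Library.Extended_Nat"
    "HOL-Computational_Algebra.Polynomial"
    "HOL-Computational_Algebra.Formal_Power_Series"
begin

(* Positions are 0-based: the letter a_i is w ! (i - 1). As a_n = \<infinity>, the gap condition
   has no content at the last letter and is only imposed where a next letter exists. *)
definition kk_words :: "nat \<Rightarrow> nat \<Rightarrow> nat \<Rightarrow> enat list set" where
  "kk_words k d n = {w. length w = n \<and> set w \<subseteq> enat ` {1..d} \<union> {\<infinity>} \<and>
     (n \<ge> 1 \<longrightarrow> last w = \<infinity>) \<and>
     (\<forall>i. Suc i < n \<longrightarrow> w ! i \<noteq> \<infinity> \<longrightarrow> w ! Suc i \<ge> w ! i + enat k)}"

lemma finite_kk_words: "finite (kk_words k d n)"
proof (rule finite_subset)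
  show "kk_words k d n \<subseteq> {w. set w \<subseteq> enat ` {1..d} \<union> {\<infinity>} \<and> length w = n}"
    by (auto simp: kk_words_def)
qed (rule finite_lists_length_eq, simp)

(* The variables s_1, ..., s_d range over an arbitrary commutative ring; taking for them the
   generators of a polynomial ring gives the polynomial S_{(k,k),d,n} itself. Values of s
   outside {1..d} are not used. *)
definition S_kk :: "nat \<Rightarrow> nat \<Rightarrow> nat \<Rightarrow> (nat \<Rightarrow> 'a::comm_ring_1) \<Rightarrow> 'a" where
  "S_kk k d n s =
     (\<Sum>w\<in>kk_words k d n. \<Prod>i\<in>{i. i < n \<and> w ! i \<noteq> \<infinity>}. s (the_enat (w ! i)))"

(* In particular the zero polynomial does not count as real-rooted. *)
definition real_rooted :: "real poly \<Rightarrow> bool" where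
  "real_rooted p \<longleftrightarrow> (\<forall>z::complex. poly (map_poly complex_of_real p) z = 0 \<longrightarrow> z \<in> \<real>)"

end

theory Submission
  imports Defs
begin

text \<open>
  As \<open>d \<le> k\<close>, a finite letter can only be followed by \<open>\<infinity>\<close>. So a nonempty word is \<open>\<infinity>\<close> followed by
  a shorter word or \<open>i \<infinity>\<close> followed by a shorter word, which gives the recurrence
  \<open>S (n + 2) = S (n + 1) + t S n\<close> with \<open>t = s 1 + \<dots> + s d\<close>. If \<open>a\<close> and \<open>b\<close> are the complex numbers with
  \<open>a + b = 1\<close> and \<open>a b = - t\<close>, then \<open>(a - b) S n = a ^ (n + 1) - b ^ (n + 1)\<close>. At a zero this
  forces \<open>|a| = |b|\<close>; together with \<open>a + b = 1\<close> this makes \<open>a\<close> and \<open>b\<close> complex conjugates, so that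
  \<open>t = - |a|\<^sup>2\<close> is real.
\<close>

lemma all_nat_split: "(\<forall>i. P i) \<longleftrightarrow> P 0 \<and> (\<forall>i. P (Suc i))"
  by (metis not0_implies_Suc)

lemma Infty_Cons_in_kk_words_iff: "\<infinity> # w \<in> kk_words k d (Suc n) \<longleftrightarrow> w \<in> kk_words k d n"
proof -
  have "(\<forall>i. Suc i < Suc n \<longrightarrow> (\<infinity> # w) ! i \<noteq> \<infinity> \<longrightarrow> (\<infinity> # w) ! Suc i \<ge> (\<infinity> # w) ! i + enat k) \<longleftrightarrow>
      (\<forall>i. Suc i < n \<longrightarrow> w ! i \<noteq> \<infinity> \<longrightarrow> w ! Suc i \<ge> w ! i + enat k)"
    by (subst all_nat_split) auto
  \<comment> \<open>For \<open>n = 0\<close> the condition on the last letter is met by the new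
    letter itself; otherwise it is inherited from \<open>w\<close>.\<close>
  then show ?thesis
    unfolding kk_words_def by (cases n) auto
qed

text \<open>Two letters are peeled off at once because a finite letter is never last in a
  word.\<close>

lemma enat_Cons_in_kk_words_iff:
  assumes "d \<le> k"
  shows "enat i # x # w \<in> kk_words k d (Suc (Suc n)) \<longleftrightarrow> i \<in> {1..d} \<and> x = \<infinity> \<and> w \<in> kk_words k d n"
proof -
  let ?v = "enat i # x # w"
  have gap: "(\<forall>j. Suc j < Suc (Suc n) \<longrightarrow> ?v ! j \<noteq> \<infinity> \<longrightarrow> ?v ! Suc j \<ge> ?v ! j + enat k) \<longleftrightarrow>
      x \<ge> enat i + enat k \<and>
      (\<forall>j. Suc j < Suc n \<longrightarrow> (x # w) ! j \<noteq> \<infinity> \<longrightarrow> (x # w) ! Suc j \<ge> (x # w) ! j + enat k)"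
    by (subst all_nat_split) auto
  have "?v \<in> kk_words k d (Suc (Suc n)) \<longleftrightarrow>
      i \<in> {1..d} \<and> x \<ge> enat i + enat k \<and> x # w \<in> kk_words k d (Suc n)"
    using gap unfolding kk_words_def by auto
  \<comment> \<open>A finite \<open>x\<close> would be at most \<open>d \<le> k\<close>, yet
    \<open>i \<ge> 1\<close> makes \<open>i + k\<close> exceed \<open>k\<close>.\<close>
  moreover have "x = \<infinity>" if "i \<in> {1..d}" "x \<ge> enat i + enat k" "x # w \<in> kk_words k d (Suc n)"
    using that assms by (cases x) (auto simp: kk_words_def)
  ultimately show ?thesis
    using Infty_Cons_in_kk_words_iff by auto
qed

lemma kk_words_0: "kk_words k d 0 = {[]}"
  by (auto simp: kk_words_def)

lemma kk_words_1: "kk_words k d (Suc 0) = {[\<infinity>]}"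
  by (auto simp: kk_words_def length_Suc_conv)

lemma kk_words_Suc_Suc:
  assumes "d \<le> k"
  shows "kk_words k d (Suc (Suc n)) =
    (#) \<infinity> ` kk_words k d (Suc n) \<union> (\<lambda>(i, w). enat i # \<infinity> # w) ` ({1..d} \<times> kk_words k d n)"
    (is "?L = ?R")
proof (intro equalityI subsetI)
  fix v assume v: "v \<in> ?L"
  then have "length v = Suc (Suc n)"
    by (simp add: kk_words_def)
  then obtain x y w where "v = x # y # w"
    by (auto simp: length_Suc_conv)
  with v show "v \<in> ?R"
    by (cases x) (auto simp: Infty_Cons_in_kk_words_iff enat_Cons_in_kk_words_iff[OF assms])
qed (auto simp: Infty_Cons_in_kk_words_iff enat_Cons_in_kk_words_iff[OF assms])

text \<open>Weight 1 for \<open>\<infinity>\<close> turns the product over finite positions into one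
  over the whole list, which splits along \<open>#\<close>.\<close>

definition letter_weight :: "(nat \<Rightarrow> 'a::comm_ring_1) \<Rightarrow> enat \<Rightarrow> 'a" where
  "letter_weight s x = (case x of enat i \<Rightarrow> s i | \<infinity> \<Rightarrow> 1)"

lemma S_kk_conv_prod_list:
  "S_kk k d n s = (\<Sum>w\<in>kk_words k d n. \<Prod>x\<leftarrow>w. letter_weight s x)"
  unfolding S_kk_def
proof (rule sum.cong[OF refl])
  fix w assume "w \<in> kk_words k d n"
  then have [simp]: "length w = n"
    by (simp add: kk_words_def)
  have "(\<Prod>i\<in>{i. i < n \<and> w ! i \<noteq> \<infinity>}. s (the_enat (w ! i))) =
      (\<Prod>i\<in>{0..<n}. letter_weight s (w ! i))"
    by (rule prod.mono_neutral_cong_left) (auto simp: letter_weight_def split: enat.splits)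
  then show "(\<Prod>i\<in>{i. i < n \<and> w ! i \<noteq> \<infinity>}. s (the_enat (w ! i))) = (\<Prod>x\<leftarrow>w. letter_weight s x)"
    by (simp add: prod.list_conv_set_nth)
qed

lemma S_kk_0: "S_kk k d 0 s = 1"
  by (simp add: S_kk_conv_prod_list kk_words_0)

lemma S_kk_1: "S_kk k d (Suc 0) s = 1"
  by (simp add: S_kk_conv_prod_list kk_words_1 letter_weight_def)

lemma S_kk_Suc_Suc:
  assumes "d \<le> k"
  shows "S_kk k d (Suc (Suc n)) s = S_kk k d (Suc n) s + (\<Sum>i=1..d. s i) * S_kk k d n s"
proof -
  let ?f = "\<lambda>w. \<Prod>x\<leftarrow>w. letter_weight s x"
  let ?g = "\<lambda>(i, w). enat i # \<infinity> # w"
  have "S_kk k d (Suc (Suc n)) s =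
      sum ?f ((#) \<infinity> ` kk_words k d (Suc n)) + sum ?f (?g ` ({1..d} \<times> kk_words k d n))"
    unfolding S_kk_conv_prod_list kk_words_Suc_Suc[OF assms]
    by (rule sum.union_disjoint) (auto simp: finite_kk_words)
  also have "sum ?f ((#) \<infinity> ` kk_words k d (Suc n)) = S_kk k d (Suc n) s"
    by (subst sum.reindex) (simp_all add: S_kk_conv_prod_list letter_weight_def[of s \<infinity>])
  also have "sum ?f (?g ` ({1..d} \<times> kk_words k d n)) =
      (\<Sum>(i, w)\<in>{1..d} \<times> kk_words k d n. s i * ?f w)"
    by (subst sum.reindex) (auto simp: inj_on_def letter_weight_def intro!: sum.cong)
  also have "\<dots> = (\<Sum>i=1..d. s i) * S_kk k d n s"
    by (simp add: S_kk_conv_prod_list sum_product sum.cartesian_product)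
  finally show ?thesis .
qed

text \<open>The ring stays arbitrary so that the recurrence serves for \<open>S_kk\<close> in
  general, for real polynomials, and for their values at a complex point.\<close>

locale fibonacci_like =
  fixes f :: "nat \<Rightarrow> 'a::comm_ring_1" and t :: 'a
  assumes f_0: "f 0 = 1" and f_1: "f (Suc 0) = 1"
    and f_Suc_Suc: "f (Suc (Suc n)) = f (Suc n) + t * f n"
begin

lemma generating_function:
  "Abs_fps f * (1 - fps_X - fps_const t * fps_X ^ 2) = 1"
proof (rule fps_ext)
  fix n
  have *: "Abs_fps f * (1 - fps_X - fps_const t * fps_X ^ 2) =
      Abs_fps f - Abs_fps f * fps_X - fps_const t * (Abs_fps f * fps_X ^ 2)"
    by (simp add: algebra_simps)
  consider "n = 0" | "n = Suc 0" | m where "n = Suc (Suc m)"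
    by (metis not0_implies_Suc)
  then show "fps_nth (Abs_fps f * (1 - fps_X - fps_const t * fps_X ^ 2)) n = fps_nth 1 n"
    unfolding * by cases (simp_all add: f_0 f_1 f_Suc_Suc fps_X_power_mult_right_nth)
qed

lemma binomial_sum:
  "f n = (\<Sum>j=0..n div 2. of_nat ((n - j) choose j) * t ^ j)"
proof -
  \<comment> \<open>The range \<open>j \<le> n\<close> only adds vanishing binomials, since
    \<open>n - j < j\<close> beyond \<open>n div 2\<close>, and it keeps the parity of
    \<open>n\<close> out of the induction.\<close>
  have "f n = (\<Sum>j\<le>n. of_nat ((n - j) choose j) * t ^ j)"
  proof (induction n rule: induct_nat_012)
    case (ge2 n)
    let ?F = "\<lambda>n j. of_nat ((n - j) choose j) * t ^ j"
    \<comment> \<open>This is Pascal's rule; \<open>j \<le> n\<close> keeps the natural subtraction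
      from truncating.\<close>
    have step: "?F (Suc (Suc n)) (Suc j) = ?F (Suc n) (Suc j) + t * ?F n j" if "j \<le> n" for j
      using that by (simp add: Suc_diff_le algebra_simps)
    have "(\<Sum>j\<le>Suc (Suc n). ?F (Suc (Suc n)) j) = (\<Sum>j\<le>Suc n. ?F (Suc (Suc n)) j)"
      by simp
    also have "\<dots> = 1 + (\<Sum>j\<le>n. ?F (Suc (Suc n)) (Suc j))"
      by (subst sum.atMost_Suc_shift) simp
    also have "(\<Sum>j\<le>n. ?F (Suc (Suc n)) (Suc j)) = (\<Sum>j\<le>n. ?F (Suc n) (Suc j) + t * ?F n j)"
      by (intro sum.cong refl step) simp
    also have "1 + \<dots> = 1 + (\<Sum>j\<le>n. ?F (Suc n) (Suc j)) + t * (\<Sum>j\<le>n. ?F n j)"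
      by (simp only: sum.distrib sum_distrib_left add.assoc)
    also have "1 + (\<Sum>j\<le>n. ?F (Suc n) (Suc j)) = (\<Sum>j\<le>Suc n. ?F (Suc n) j)"
      by (subst sum.atMost_Suc_shift) simp
    finally show ?case
      using ge2 by (simp only: f_Suc_Suc)
  qed (simp_all add: f_0 f_1)
  also have "\<dots> = (\<Sum>j=0..n div 2. of_nat ((n - j) choose j) * t ^ j)"
    by (intro sum.mono_neutral_right) (auto simp: binomial_eq_0)
  finally show ?thesis .
qed

text \<open>Here \<open>a\<close> and \<open>b\<close> are roots of \<open>X^2 - X - t\<close>, so
  both sides obey the same recurrence. The factor \<open>a - b\<close> is kept on the left to avoid
  division, which also covers \<open>a = b\<close>.\<close>

lemma binet:
  assumes "a + b = 1" and "a * b = - t"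
  shows "(a - b) * f n = a ^ Suc n - b ^ Suc n"
proof (induction n rule: induct_nat_012)
  case (ge2 n)
  have "(a - b) * f (Suc (Suc n)) = (a + b) * ((a - b) * f (Suc n)) - a * b * ((a - b) * f n)"
    using assms by (simp add: f_Suc_Suc algebra_simps)
  also have "\<dots> = a ^ Suc (Suc (Suc n)) - b ^ Suc (Suc (Suc n))"
    unfolding ge2 by (simp add: algebra_simps)
  finally show ?case .
next
  case 1
  have "(a - b) * f (Suc 0) = (a - b) * (a + b)"
    by (simp add: f_1 assms(1))
  then show ?case
    by (simp add: algebra_simps)
qed (simp add: f_0)

end

lemma fibonacci_like_zero_real:
  fixes f :: "nat \<Rightarrow> complex"
  assumes "fibonacci_like f t" and "f n = 0"
  shows "t \<in> \<real>"
proof -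
  define a b where "a = (1 + csqrt (1 + 4 * t)) / 2" and "b = (1 - csqrt (1 + 4 * t)) / 2"
  have ab: "a + b = 1" "a * b = - t"
    by (simp_all add: a_def b_def field_simps flip: power2_eq_square)
  have "a ^ Suc n = b ^ Suc n"
    using fibonacci_like.binet[OF assms(1) ab, of n] assms(2) by simp
  then have "norm a ^ Suc n = norm b ^ Suc n"
    by (metis norm_power)
  \<comment> \<open>The exponent \<open>Suc n\<close> is positive, so powers of nonnegative reals
    determine their base.\<close>
  then have "norm a = norm b"
    by (metis norm_ge_zero power_inject_base)
  moreover have b: "b = 1 - a"
    using ab(1) by (simp add: algebra_simps)
  \<comment> \<open>The imaginary parts of \<open>a\<close> and \<open>1 - a\<close> are opposite,
    so their squares cancel.\<close>
  ultimately have "(Re a)\<^sup>2 = (1 - Re a)\<^sup>2"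
    by (simp add: norm_complex_def)
  then have "Re a = 1 / 2"
    by (simp add: power2_eq_square algebra_simps)
  then have "b = cnj a"
    by (simp add: b complex_eq_iff)
  then have "t = - complex_of_real ((norm a)\<^sup>2)"
    using ab(2) by (metis complex_norm_square minus_minus)
  then show ?thesis
    by (metis Reals_minus Reals_of_real)
qed

lemma poly_map_of_real_add:
  "poly (map_poly complex_of_real (p + q)) z =
    poly (map_poly complex_of_real p) z + poly (map_poly complex_of_real q) z"
proof -
  have "map_poly complex_of_real (p + q) = map_poly complex_of_real p + map_poly complex_of_real q"
    by (rule poly_eqI) (simp add: coeff_map_poly)
  then show ?thesis
    by simp
qed

lemma poly_map_of_real_mult:
  "poly (map_poly complex_of_real (p * q)) z =
    poly (map_poly complex_of_real p) z * poly (map_poly complex_of_real q) z"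
proof -
  have "map_poly complex_of_real (p * q) = map_poly complex_of_real p * map_poly complex_of_real q"
    by (rule poly_eqI) (simp add: coeff_map_poly coeff_mult)
  then show ?thesis
    by simp
qed

lemma fibonacci_like_S_kk: "d \<le> k \<Longrightarrow> fibonacci_like (\<lambda>n. S_kk k d n s) (\<Sum>i=1..d. s i)"
  by unfold_locales (simp_all add: S_kk_0 S_kk_1 S_kk_Suc_Suc)

text \<open>Evaluation at \<open>z\<close> is a ring homomorphism, so the values at a zero
  \<open>z\<close> satisfy the complex recurrence with parameter \<open>c + z\<close>; this is then
  real, and hence so is \<open>z\<close>.\<close>

lemma real_rooted_fibonacci_like:
  assumes "fibonacci_like f [:c, 1:]"
  shows "real_rooted (f n)"
  unfolding real_rooted_def
proof (intro allI impI)
  fix z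
  assume zero: "poly (map_poly complex_of_real (f n)) z = 0"
  interpret fibonacci_like f "[:c, 1:]"
    by fact
  have "fibonacci_like (\<lambda>n. poly (map_poly complex_of_real (f n)) z) (of_real c + z)"
    \<comment> \<open>The rule \<open>mult_pCons_left\<close> would expand the product with
      \<open>[:c, 1:]\<close> before evaluation is distributed over it.\<close>
    by unfold_locales
       (simp_all add: f_0 f_1 f_Suc_Suc poly_map_of_real_add poly_map_of_real_mult map_poly_pCons
         del: mult_pCons_left)
  from fibonacci_like_zero_real[OF this, OF zero] show "z \<in> \<real>"
    by (metis Reals_diff Reals_of_real add_diff_cancel_left')
qed

theorem theorem5p1:
  fixes k d :: nat and s :: "nat \<Rightarrow> 'a::comm_ring_1"
  assumes "k \<ge> 1" and "1 \<le> d" and "d \<le> k"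
  shows "Abs_fps (\<lambda>n. S_kk k d n s) *
           (1 - fps_X - fps_const (\<Sum>i=1..d. s i) * fps_X ^ 2) = 1
    \<and> (\<forall>n. S_kk k d n s =
           (\<Sum>j=0..n div 2. of_nat ((n - j) choose j) * (\<Sum>i=1..d. s i) ^ j))
    \<and> (\<forall>n. S_kk k d n (\<lambda>i. if i = 1 then [:0, 1:] else 1) =
           (\<Sum>j=0..n div 2. of_nat ((n - j) choose j) * ([:0, 1:] + of_nat d - 1 :: real poly) ^ j)
         \<and> real_rooted (S_kk k d n (\<lambda>i. if i = 1 then [:0, 1:] else 1)))"
proof -
  let ?s = "\<lambda>i. if i = 1 then [:0, 1:] else 1 :: real poly"
  have "(\<Sum>i=1..d. ?s i) = [:0, 1:] + (\<Sum>i=Suc 1..d. 1)"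
    using \<open>1 \<le> d\<close> by (subst sum.atLeast_Suc_atMost) auto
  then have sum_s: "(\<Sum>i=1..d. ?s i) = [:0, 1:] + of_nat d - 1"
    using \<open>1 \<le> d\<close> by (simp add: of_nat_diff)
  have linear: "[:0, 1:] + of_nat d - 1 = [:real d - 1, 1:]"
    by (simp add: of_nat_poly one_pCons)
  interpret fibonacci_like "\<lambda>n. S_kk k d n s" "\<Sum>i=1..d. s i"
    using \<open>d \<le> k\<close> by (rule fibonacci_like_S_kk)
  interpret uni: fibonacci_like "\<lambda>n. S_kk k d n ?s" "[:0, 1:] + of_nat d - 1"
    using fibonacci_like_S_kk[OF \<open>d \<le> k\<close>, of ?s] unfolding sum_s .
  show ?thesis
    using generating_function binomial_sum uni.binomial_sum
      real_rooted_fibonacci_like[OF uni.fibonacci_like_axioms[unfolded linear]]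
    by blast
qed

end
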